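(* For every positive integer $k$, with $n = 3^k$ and $A_k = \{x \in \{0,1\}^n : \mathrm{RecMaj}_k(x) = 1\}$, there exists a bijection $\phi \colon \{0,1\}^{n-1} \to A_k$ such that $\mathrm{avgstretch}(\phi) \le 20$.
   Context: The recursive majority of 3's, $\mathrm{RecMaj}_k \colon \{0,1\}^{3^k} \to \{0,1\}$, is defined by: $\mathrm{RecMaj}_1$ is the majority of its 3 input bits; for $k>1$, writing $x = x^{(1)} \circ x^{(2)} \circ x^{(3)}$ with each $x^{(r)} \in \{0,1\}^{3^{k-1}}$ (consecutive thirds), $\mathrm{RecMaj}_k(x) = \mathrm{Maj}(\mathrm{RecMaj}_{k-1}(x^{(1)}),\mathrm{RecMaj}_{k-1}(x^{(2)}),\mathrm{RecMaj}_{k-1}(x^{(3)}))$. One has $|A_k| = 2^{n-1}$. $\mathrm{dist}$ is the Hamming distance, and for a bijection $\phi \colon \{0,1\}^{n-1} \to A_k$, $\mathrm{avgstretch}(\phi) = \mathbb{E}[\mathrm{dist}(\phi(x),\phi(x'))]$ over a uniformly random pair $x,x' \in \{0,1\}^{n-1}$ differing in exactly one coordinate. *)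

theory Defs
  imports "HOL-Probability.Probability"
begin

definition cube :: "nat \<Rightarrow> bool list set" where
  "cube n = {x. length x = n}"

definition hamming_dist :: "bool list \<Rightarrow> bool list \<Rightarrow> nat" where
  "hamming_dist x y = card {i. i < length x \<and> x ! i \<noteq> y ! i}"

definition maj :: "bool \<Rightarrow> bool \<Rightarrow> bool \<Rightarrow> bool" where
  "maj a b c \<longleftrightarrow> (a \<and> b) \<or> (a \<and> c) \<or> (b \<and> c)"

text \<open>
  The level starts at 1; \<open>rec_maj 0\<close> is left unspecified. At level \<open>k\<close> the function is meant to
  be applied to lists of length \<open>3 ^ k\<close>.
\<close>

fun rec_maj :: "nat \<Rightarrow> bool list \<Rightarrow> bool" where
  "rec_maj (Suc 0) x = maj (x ! 0) (x ! 1) (x ! 2)"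
| "rec_maj (Suc (Suc k)) x =
     (let m = 3 ^ Suc k in
      maj (rec_maj (Suc k) (take m x))
          (rec_maj (Suc k) (take m (drop m x)))
          (rec_maj (Suc k) (take m (drop (2 * m) x))))"

definition rec_maj_set :: "nat \<Rightarrow> bool list set" where
  "rec_maj_set k = {x \<in> cube (3 ^ k). rec_maj k x}"

definition cube_edges :: "nat \<Rightarrow> (bool list \<times> bool list) set" where
  "cube_edges n = {(x, y). x \<in> cube n \<and> y \<in> cube n \<and> hamming_dist x y = 1}"

text \<open>
  \<open>cube_edges n\<close> consists of ordered pairs. It is finite, and nonempty for \<open>n \<ge> 1\<close>, so that
  \<open>pmf_of_set\<close> is then the uniform distribution on it.
\<close>

definition avgstretch :: "nat \<Rightarrow> (bool list \<Rightarrow> bool list) \<Rightarrow> real" where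
  "avgstretch n \<phi> =
     measure_pmf.expectation (pmf_of_set (cube_edges n))
       (\<lambda>(x, y). real (hamming_dist (\<phi> x) (\<phi> y)))"

end

theory Submission
  imports Defs
begin

text \<open>
  For every \<open>k\<close> we build bijections \<open>\<phi>\<^sub>k\<^sup>1\<close> and \<open>\<phi>\<^sub>k\<^sup>0\<close> from the cube of dimension \<open>3\<^sup>k - 1\<close> onto the
  1-inputs and the 0-inputs of the recursive majority. Two of the input bits select one of the four
  triples of block values with the prescribed majority; the other bits are split into three parts,
  and the part belonging to a block of value \<open>p\<close> is mapped by \<open>\<phi>\<^sub>k\<^sub>-\<^sub>1\<^sup>p\<close>.
  The selection is arranged so that the triples used by \<open>\<phi>\<^sub>k\<^sup>1\<close> and \<open>\<phi>\<^sub>k\<^sup>0\<close> for the same selector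
  have average distance \<open>3/2\<close>; hence \<open>\<phi>\<^sub>k\<^sup>1 x\<close> and \<open>\<phi>\<^sub>k\<^sup>0 x\<close> have average distance \<open>(3/2)\<^sup>k\<close>.
  Flipping a selector bit changes \<open>3/2\<close> blocks on average, each at cost \<open>(3/2)\<^sup>k\<^sup>-\<^sup>1\<close>, so the stretch
  summed over all directions satisfies \<open>S\<^sub>k = 3 S\<^sub>k\<^sub>-\<^sub>1 + 3 (3/2)\<^sup>k\<^sup>-\<^sup>1\<close>, that is
  \<open>S\<^sub>k = 2 (3\<^sup>k - (3/2)\<^sup>k)\<close>, and the average over the \<open>3\<^sup>k - 1\<close> directions is at most \<open>2\<close>.
\<close>

subsection \<open>Hamming distance\<close>

lemma hamming_dist_Nil [simp]: "hamming_dist [] y = 0"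
  by (simp add: hamming_dist_def)

lemma hamming_dist_Cons [simp]:
  "hamming_dist (a # x) (b # y) = of_bool (a \<noteq> b) + hamming_dist x y"
proof -
  have "{i. i < length (a # x) \<and> (a # x) ! i \<noteq> (b # y) ! i} =
      (if a \<noteq> b then {0} else {}) \<union> Suc ` {i. i < length x \<and> x ! i \<noteq> y ! i}"
    (is "?L = ?R")
  proof (rule set_eqI)
    show "i \<in> ?L \<longleftrightarrow> i \<in> ?R" for i by (cases i) auto
  qed
  then show ?thesis
    by (simp add: hamming_dist_def card_Un_disjoint card_image)
qed

lemma hamming_dist_append:
  "length x = length y \<Longrightarrow>
   hamming_dist (x @ u) (y @ v) = hamming_dist x y + hamming_dist u v"
  by (induction x y rule: list_induct2) auto

lemma hamming_dist_self [simp]: "hamming_dist x x = 0"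
  by (simp add: hamming_dist_def)

lemma hamming_dist_commute: "length x = length y \<Longrightarrow> hamming_dist x y = hamming_dist y x"
  by (induction x y rule: list_induct2) auto

definition flip_bit :: "nat \<Rightarrow> bool list \<Rightarrow> bool list" where
  "flip_bit i x = x[i := \<not> x ! i]"

lemma length_flip_bit [simp]: "length (flip_bit i x) = length x"
  by (simp add: flip_bit_def)

lemma nth_flip_bit: "i < length x \<Longrightarrow> flip_bit i x ! j = (x ! j \<noteq> (i = j))"
  by (auto simp: flip_bit_def nth_list_update)

lemma flip_bit_Cons_0 [simp]: "flip_bit 0 (b # x) = (\<not> b) # x"
  and flip_bit_Cons_Suc [simp]: "flip_bit (Suc i) (b # x) = b # flip_bit i x"
  by (simp_all add: flip_bit_def)

lemma hamming_dist_eq_1_iff: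
  assumes "length x = length y"
  shows "hamming_dist x y = 1 \<longleftrightarrow> (\<exists>i<length x. y = flip_bit i x)"
proof
  assume "hamming_dist x y = 1"
  then obtain i where i: "{j. j < length x \<and> x ! j \<noteq> y ! j} = {i}"
    unfolding hamming_dist_def by (rule card_1_singletonE)
  then have less: "i < length x" by blast
  moreover have "y = flip_bit i x"
  proof (rule nth_equalityI)
    fix j assume "j < length y"
    with assms have "j \<in> {j. j < length x \<and> x ! j \<noteq> y ! j} \<longleftrightarrow> x ! j \<noteq> y ! j" by simp
    with i show "y ! j = flip_bit i x ! j" using less by (auto simp: nth_flip_bit)
  qed (simp add: assms)
  ultimately show "\<exists>i<length x. y = flip_bit i x" by blast
next
  assume "\<exists>i<length x. y = flip_bit i x"
  then obtain i where "i < length x" "y = flip_bit i x" by blast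
  then have "{j. j < length x \<and> x ! j \<noteq> y ! j} = {i}" by (auto simp: nth_flip_bit)
  then show "hamming_dist x y = 1" by (simp add: hamming_dist_def)
qed

subsection \<open>Averages over the cube\<close>

lemma cube_0: "cube 0 = {[]}"
  by (simp add: cube_def)

lemma finite_cube [simp]: "finite (cube n)"
  using finite_lists_length_eq[of "UNIV :: bool set"] by (simp add: cube_def)

lemma card_cube: "card (cube n) = 2 ^ n"
  using card_lists_length_eq[of "UNIV :: bool set"] by (simp add: cube_def)

lemma cube_Suc: "cube (Suc n) = (#) True ` cube n \<union> (#) False ` cube n"
  by (auto simp: cube_def length_Suc_conv image_iff)

definition cube_mean :: "nat \<Rightarrow> (bool list \<Rightarrow> real) \<Rightarrow> real" where
  "cube_mean n g = (\<Sum>x\<in>cube n. g x) / 2 ^ n"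

lemma cube_mean_0 [simp]: "cube_mean 0 g = g []"
  by (simp add: cube_mean_def cube_0)

lemma cube_mean_Suc:
  "cube_mean (Suc n) g =
     (cube_mean n (\<lambda>x. g (True # x)) + cube_mean n (\<lambda>x. g (False # x))) / 2"
proof -
  have "sum g (cube (Suc n)) = sum g ((#) True ` cube n) + sum g ((#) False ` cube n)"
    unfolding cube_Suc by (rule sum.union_disjoint) auto
  then show ?thesis
    by (simp add: cube_mean_def sum.reindex add_divide_distrib)
qed

lemma cube_mean_append: "cube_mean (a + b) g = cube_mean a (\<lambda>x. cube_mean b (\<lambda>u. g (x @ u)))"
  by (induction a arbitrary: g) (simp_all add: cube_mean_Suc)

lemma cube_mean_cong: "(\<And>x. x \<in> cube n \<Longrightarrow> f x = g x) \<Longrightarrow> cube_mean n f = cube_mean n g"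
  by (simp add: cube_mean_def)

lemma cube_mean_const [simp]: "cube_mean n (\<lambda>_. c) = c"
  by (simp add: cube_mean_def card_cube)

lemma cube_mean_add: "cube_mean n (\<lambda>x. f x + g x) = cube_mean n f + cube_mean n g"
  by (simp add: cube_mean_def sum.distrib add_divide_distrib)

definition mean_dist :: "nat \<Rightarrow> (bool list \<Rightarrow> bool list) \<Rightarrow> (bool list \<Rightarrow> bool list) \<Rightarrow> real" where
  "mean_dist n f g = cube_mean n (\<lambda>x. hamming_dist (f x) (g x))"

definition total_stretch :: "nat \<Rightarrow> (bool list \<Rightarrow> bool list) \<Rightarrow> real" where
  "total_stretch n f = cube_mean n (\<lambda>x. \<Sum>i<n. hamming_dist (f x) (f (flip_bit i x)))"

lemma mean_dist_self [simp]: "mean_dist n f f = 0"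
  by (simp add: mean_dist_def)

lemma mean_dist_commute:
  assumes "\<And>x. length (f x) = length (g x)"
  shows "mean_dist n f g = mean_dist n g f"
  unfolding mean_dist_def using assms by (simp add: hamming_dist_commute)

lemma mean_dist_Suc:
  "mean_dist (Suc n) f g =
     (mean_dist n (\<lambda>x. f (True # x)) (\<lambda>x. g (True # x)) +
      mean_dist n (\<lambda>x. f (False # x)) (\<lambda>x. g (False # x))) / 2"
  by (simp add: mean_dist_def cube_mean_Suc)

lemma mean_dist_append:
  assumes "\<And>x. length (f x) = length (f' x)"
  shows "mean_dist (a + b) (\<lambda>z. f (take a z) @ g (drop a z)) (\<lambda>z. f' (take a z) @ g' (drop a z)) =
    mean_dist a f f' + mean_dist b g g'" (is "?lhs = _")
proof -
  have "?lhs = cube_mean a (\<lambda>x. hamming_dist (f x) (f' x) + mean_dist b g g')"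
    unfolding mean_dist_def cube_mean_append
    by (intro cube_mean_cong) (simp add: cube_def hamming_dist_append assms cube_mean_add)
  then show ?thesis by (simp add: cube_mean_add mean_dist_def)
qed

lemma total_stretch_Suc:
  assumes "\<And>x. length (f (True # x)) = length (f (False # x))"
  shows "total_stretch (Suc n) f =
    (total_stretch n (\<lambda>x. f (True # x)) + total_stretch n (\<lambda>x. f (False # x))) / 2 +
    mean_dist n (\<lambda>x. f (True # x)) (\<lambda>x. f (False # x))"
proof -
  have "mean_dist n (\<lambda>x. f (False # x)) (\<lambda>x. f (True # x)) =
      mean_dist n (\<lambda>x. f (True # x)) (\<lambda>x. f (False # x))"
    by (rule mean_dist_commute) (simp add: assms)
  then show ?thesis
    by (simp add: total_stretch_def mean_dist_def cube_mean_Suc cube_mean_add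
        sum.lessThan_Suc_shift add_divide_distrib del: sum.lessThan_Suc)
qed

lemma total_stretch_append:
  assumes "\<And>x y. length (f x) = length (f y)"
  shows "total_stretch (a + b) (\<lambda>z. f (take a z) @ g (drop a z)) =
    total_stretch a f + total_stretch b g"
  using assms
proof (induction a arbitrary: f)
  case 0
  then show ?case by (simp add: total_stretch_def hamming_dist_append)
next
  case (Suc a)
  have len: "length (f x) = length (f y)" for x y
    by (rule Suc.prems)
  have "total_stretch (a + b) (\<lambda>z. f (c # take a z) @ g (drop a z)) =
      total_stretch a (\<lambda>x. f (c # x)) + total_stretch b g" for c
    by (rule Suc.IH) (rule len)
  moreover have "mean_dist (a + b) (\<lambda>z. f (True # take a z) @ g (drop a z))
      (\<lambda>z. f (False # take a z) @ g (drop a z)) =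
      mean_dist a (\<lambda>x. f (True # x)) (\<lambda>x. f (False # x)) + mean_dist b g g"
    by (rule mean_dist_append) (rule len)
  ultimately show ?case
    by (simp add: total_stretch_Suc len[of "True # _" "False # _"])
qed

lemma sum_cube_edges:
  "(\<Sum>(x, y)\<in>cube_edges n. F x y) = (\<Sum>x\<in>cube n. \<Sum>i<n. F x (flip_bit i x))"
proof -
  let ?edge = "\<lambda>(x, i). (x, flip_bit i x)"
  have edges: "cube_edges n = ?edge ` (cube n \<times> {..<n})"
    by (force simp: cube_edges_def cube_def hamming_dist_eq_1_iff[simplified])
  have inj: "inj_on ?edge (cube n \<times> {..<n})"
    by (auto simp: inj_on_def cube_def list_eq_iff_nth_eq nth_flip_bit)
  show ?thesis
    unfolding edges sum.reindex[OF inj] by (simp add: sum.cartesian_product case_prod_unfold)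
qed

lemma card_cube_edges: "card (cube_edges n) = n * 2 ^ n"
  using sum_cube_edges[of "\<lambda>_ _. 1 :: nat" n] by (simp add: card_cube)

lemma finite_cube_edges [simp]: "finite (cube_edges n)"
  by (rule finite_subset[of _ "cube n \<times> cube n"]) (auto simp: cube_edges_def)

lemma avgstretch_eq_total_stretch:
  assumes "n \<ge> 1"
  shows "avgstretch n \<phi> = total_stretch n \<phi> / n"
proof -
  have "cube_edges n \<noteq> {}" using assms card_cube_edges[of n] by auto
  then have "avgstretch n \<phi> =
      (\<Sum>(x, y)\<in>cube_edges n. real (hamming_dist (\<phi> x) (\<phi> y))) / (real n * 2 ^ n)"
    by (simp add: avgstretch_def integral_pmf_of_set card_cube_edges)
  then show ?thesis
    by (simp add: sum_cube_edges total_stretch_def cube_mean_def)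
qed

subsection \<open>Maps acting on blocks\<close>

primrec block_map ::
  "nat \<Rightarrow> ('a \<Rightarrow> 'b list \<Rightarrow> 'c list) \<Rightarrow> 'a list \<Rightarrow> 'b list \<Rightarrow> 'c list" where
  "block_map m f [] z = []"
| "block_map m f (p # ps) z = f p (take m z) @ block_map m f ps (drop m z)"

lemma length_block_map:
  assumes "\<And>p x. length (f p x) = l"
  shows "length (block_map m f ps z) = length ps * l"
  by (induction ps arbitrary: z) (simp_all add: assms)

lemma block_map_inject:
  assumes "\<And>p x. length (f p x) = l"
    and "inj_on (\<lambda>(p, x). f p x) (UNIV \<times> cube m)"
    and "length ps = length qs" "length z = length ps * m" "length w = length ps * m"
  shows "block_map m f ps z = block_map m f qs w \<longleftrightarrow> ps = qs \<and> z = w"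
  using assms(3-)
proof (induction ps qs arbitrary: z w rule: list_induct2)
  case (Cons p ps q qs)
  have head: "f p (take m z) = f q (take m w) \<longleftrightarrow> p = q \<and> take m z = take m w"
    using inj_on_eq_iff[OF assms(2), of "(p, take m z)" "(q, take m w)"] Cons.prems
    by (simp add: cube_def)
  have tail: "block_map m f ps (drop m z) = block_map m f qs (drop m w) \<longleftrightarrow>
      ps = qs \<and> drop m z = drop m w"
    by (rule Cons.IH) (simp_all add: Cons.prems)
  have "z = w \<longleftrightarrow> take m z = take m w \<and> drop m z = drop m w"
    by (metis append_take_drop_id)
  then show ?case by (auto simp: assms(1) head tail)
qed simp

lemma mean_dist_block_map:
  assumes "\<And>p x. length (f p x) = l" and "length ps = length qs"
  shows "mean_dist (length ps * m) (block_map m f ps) (block_map m f qs) =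
    hamming_dist ps qs * mean_dist m (f True) (f False)"
  using assms(2)
proof (induction ps qs rule: list_induct2)
  case (Cons p ps q qs)
  have "mean_dist m (f p) (f q) = of_bool (p \<noteq> q) * mean_dist m (f True) (f False)"
    using mean_dist_commute[of "f True" "f False" m] assms(1) by (cases p; cases q) auto
  then show ?case
    using Cons by (simp add: mean_dist_append assms(1) algebra_simps)
qed (simp add: mean_dist_def)

lemma total_stretch_block_map:
  assumes "\<And>p x. length (f p x) = l"
  shows "total_stretch (length ps * m) (block_map m f ps) = (\<Sum>p\<leftarrow>ps. total_stretch m (f p))"
proof (induction ps)
  case Nil
  show ?case by (simp add: total_stretch_def)
next
  case (Cons p ps)
  then show ?case by (simp add: total_stretch_append assms)
qed

subsection \<open>Recursive majority\<close>

text \<open>Unlike \<^const>\<open>rec_maj\<close>, which is unspecified at level 0, this is the identity there.\<close>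

definition maj_tree :: "nat \<Rightarrow> bool list \<Rightarrow> bool" where
  "maj_tree k x = (if k = 0 then x ! 0 else rec_maj k x)"

lemma maj_tree_Suc:
  assumes "length u = 3 ^ k" "length v = 3 ^ k" "length w = 3 ^ k"
  shows "maj_tree (Suc k) (u @ v @ w) = maj (maj_tree k u) (maj_tree k v) (maj_tree k w)"
proof (cases k)
  case 0
  with assms obtain a b c where "u = [a]" "v = [b]" "w = [c]"
    by (auto simp: length_Suc_conv)
  with 0 show ?thesis by (simp add: maj_tree_def)
next
  case (Suc j)
  with assms show ?thesis by (simp add: maj_tree_def Let_def)
qed

text \<open>
  Around the cycle \<open>00, 01, 11, 10\<close> of selectors consecutive triples are at distance \<open>1, 2, 2, 1\<close>,
  and for the same selector the triples of the two majorities are at distance \<open>3, 1, 1, 1\<close>.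
\<close>

fun maj_preimage :: "bool \<Rightarrow> bool \<Rightarrow> bool \<Rightarrow> bool list" where
  "maj_preimage True False False = [True, True, True]"
| "maj_preimage True False True = [True, True, False]"
| "maj_preimage True True True = [True, False, True]"
| "maj_preimage True True False = [False, True, True]"
| "maj_preimage False False False = [False, False, False]"
| "maj_preimage False False True = [True, False, False]"
| "maj_preimage False True True = [False, False, True]"
| "maj_preimage False True False = [False, True, False]"

lemma length_maj_preimage [simp]: "length (maj_preimage b s t) = 3"
  by (cases b; cases s; cases t) simp_all

lemma maj_preimage_inject:
  "maj_preimage b s t = maj_preimage b' s' t' \<longleftrightarrow> b = b' \<and> s = s' \<and> t = t'"
  by (cases b; cases s; cases t; cases b'; cases s'; cases t') simp_all

lemma maj_maj_preimage: "\<exists>p q r. maj_preimage b s t = [p, q, r] \<and> maj p q r = b"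
  by (cases b; cases s; cases t) (simp_all add: maj_def ex_bool_eq)

primrec rec_maj_bij :: "nat \<Rightarrow> bool \<Rightarrow> bool list \<Rightarrow> bool list" where
  "rec_maj_bij 0 b x = [b]"
| "rec_maj_bij (Suc k) b x =
     block_map (3 ^ k - 1) (rec_maj_bij k) (maj_preimage b (x ! 0) (x ! 1)) (drop 2 x)"

lemma rec_maj_bij_Suc_Cons:
  "rec_maj_bij (Suc k) b (s # t # z) =
     block_map (3 ^ k - 1) (rec_maj_bij k) (maj_preimage b s t) z"
  by simp

lemma length_rec_maj_bij: "length (rec_maj_bij k b x) = 3 ^ k"
  by (induction k arbitrary: b x) (simp_all add: length_block_map)

lemma three_power_Suc_minus_1: "3 ^ Suc k - 1 = Suc (Suc (3 * (3 ^ k - 1 :: nat)))"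
  by (cases "3 ^ k :: nat") simp_all

lemma maj_tree_rec_maj_bij: "maj_tree k (rec_maj_bij k b x) = b"
proof (induction k arbitrary: b x)
  case 0
  show ?case by (simp add: maj_tree_def)
next
  case (Suc k)
  obtain p q r where "maj_preimage b (x ! 0) (x ! 1) = [p, q, r]" "maj p q r = b"
    using maj_maj_preimage by blast
  then show ?case by (simp add: maj_tree_Suc length_rec_maj_bij Suc.IH)
qed

lemma inj_on_rec_maj_bij: "inj_on (\<lambda>(b, x). rec_maj_bij k b x) (UNIV \<times> cube (3 ^ k - 1))"
proof (induction k)
  case 0
  show ?case by (auto simp: inj_on_def cube_0)
next
  case (Suc k)
  have cube_cases: "\<exists>s t z. x = s # t # z \<and> length z = 3 * (3 ^ k - 1)"
    if "x \<in> cube (3 ^ Suc k - 1)" for x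
    using that unfolding three_power_Suc_minus_1 by (auto simp: cube_def length_Suc_conv)
  have "b = c \<and> x = y"
    if x: "x \<in> cube (3 ^ Suc k - 1)" and y: "y \<in> cube (3 ^ Suc k - 1)"
      and eq: "rec_maj_bij (Suc k) b x = rec_maj_bij (Suc k) c y" for b c x y
  proof -
    obtain s t z s' t' z' where "x = s # t # z" "length z = 3 * (3 ^ k - 1)"
      "y = s' # t' # z'" "length z' = 3 * (3 ^ k - 1)"
      using cube_cases[OF x] cube_cases[OF y] by blast
    with eq show ?thesis
      by (simp add: block_map_inject[OF length_rec_maj_bij Suc.IH] maj_preimage_inject
          del: One_nat_def)
  qed
  then show ?case by (auto intro!: inj_onI simp del: rec_maj_bij.simps)
qed

text \<open>
  Surjectivity by counting: the two cubes of dimension \<open>3 ^ k - 1\<close> together are as large as the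
  cube of dimension \<open>3 ^ k\<close>.
\<close>

lemma image_rec_maj_bij: "(\<lambda>(b, x). rec_maj_bij k b x) ` (UNIV \<times> cube (3 ^ k - 1)) = cube (3 ^ k)"
proof (rule card_subset_eq[OF finite_cube])
  have "2 * 2 ^ (3 ^ k - 1) = (2 :: nat) ^ 3 ^ k"
    by (simp flip: power_Suc)
  then show "card ((\<lambda>(b, x). rec_maj_bij k b x) ` (UNIV \<times> cube (3 ^ k - 1))) = card (cube (3 ^ k))"
    unfolding card_image[OF inj_on_rec_maj_bij] by (simp add: card_cartesian_product card_cube)
qed (auto simp: cube_def length_rec_maj_bij)

lemma bij_betw_rec_maj_bij:
  "bij_betw (rec_maj_bij k b) (cube (3 ^ k - 1)) {y \<in> cube (3 ^ k). maj_tree k y = b}"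
proof (rule bij_betw_imageI)
  show "inj_on (rec_maj_bij k b) (cube (3 ^ k - 1))"
    using inj_on_rec_maj_bij[of k] by (auto simp: inj_on_def)
  show "rec_maj_bij k b ` cube (3 ^ k - 1) = {y \<in> cube (3 ^ k). maj_tree k y = b}"
    unfolding image_rec_maj_bij[of k, symmetric] by (auto simp: maj_tree_rec_maj_bij)
qed

subsection \<open>Stretch of the bijections\<close>

lemma mean_dist_block_map_rec_maj_bij:
  "mean_dist (3 * (3 ^ k - 1))
     (block_map (3 ^ k - 1) (rec_maj_bij k) (maj_preimage b s t))
     (block_map (3 ^ k - 1) (rec_maj_bij k) (maj_preimage b' s' t')) =
   hamming_dist (maj_preimage b s t) (maj_preimage b' s' t') *
     mean_dist (3 ^ k - 1) (rec_maj_bij k True) (rec_maj_bij k False)"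
  using mean_dist_block_map[OF length_rec_maj_bij,
      of "maj_preimage b s t" "maj_preimage b' s' t'"] by simp

lemma mean_dist_rec_maj_bij:
  "mean_dist (3 ^ k - 1) (rec_maj_bij k True) (rec_maj_bij k False) = (3 / 2) ^ k"
proof (induction k)
  case 0
  show ?case by (simp add: mean_dist_def)
next
  case (Suc k)
  show ?case
    unfolding three_power_Suc_minus_1 mean_dist_Suc rec_maj_bij_Suc_Cons
      mean_dist_block_map_rec_maj_bij Suc
    by simp
qed

lemma total_stretch_rec_maj_bij:
  "total_stretch (3 ^ k - 1) (rec_maj_bij k b) = 2 * (3 ^ k - (3 / 2) ^ k)"
proof (induction k arbitrary: b)
  case 0
  show ?case by (simp add: total_stretch_def)
next
  case (Suc k)
  let ?d = "3 * (3 ^ k - 1) :: nat"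
  let ?B = "\<lambda>s t. block_map (3 ^ k - 1) (rec_maj_bij k) (maj_preimage b s t)"
  have blocks: "total_stretch ?d (?B s t) = 6 * (3 ^ k - (3 / 2) ^ k)" for s t
    using total_stretch_block_map[OF length_rec_maj_bij, of "maj_preimage b s t"]
    by (simp add: Suc.IH sum_list_triv del: One_nat_def)
  have "total_stretch (3 ^ Suc k - 1) (rec_maj_bij (Suc k) b) =
      (total_stretch ?d (?B True True) + total_stretch ?d (?B True False) +
       total_stretch ?d (?B False True) + total_stretch ?d (?B False False)) / 4 +
      (mean_dist ?d (?B True True) (?B True False) + mean_dist ?d (?B False True) (?B False False) +
       mean_dist ?d (?B True True) (?B False True) + mean_dist ?d (?B True False) (?B False False)) / 2"
    unfolding three_power_Suc_minus_1
    by (simp add: total_stretch_Suc mean_dist_Suc length_block_map[OF length_rec_maj_bij] field_simps)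
  also have "\<dots> = 6 * (3 ^ k - (3 / 2) ^ k) + 3 * (3 / 2) ^ k"
    unfolding blocks mean_dist_block_map_rec_maj_bij mean_dist_rec_maj_bij
    by (cases b) (simp_all add: field_simps)
  also have "\<dots> = 2 * (3 ^ Suc k - (3 / 2) ^ Suc k)"
    by simp
  finally show ?case .
qed

lemma avgstretch_rec_maj_bij_le:
  assumes "k \<ge> 1"
  shows "avgstretch (3 ^ k - 1) (rec_maj_bij k b) \<le> 2"
proof -
  define d :: nat where "d = 3 ^ k - 1"
  have "(3 :: nat) ^ 1 \<le> 3 ^ k"
    using assms by (intro power_increasing) auto
  then have "d \<ge> 1" by (simp add: d_def)
  moreover have "total_stretch d (rec_maj_bij k b) \<le> 2 * d"
    unfolding d_def total_stretch_rec_maj_bij by (simp add: of_nat_diff)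
  ultimately show ?thesis
    unfolding d_def[symmetric] by (simp add: avgstretch_eq_total_stretch divide_le_eq)
qed

theorem theorem3:
  fixes k n :: nat
  assumes "k \<ge> 1" and "n = 3 ^ k"
  shows "\<exists>\<phi>. bij_betw \<phi> (cube (n - 1)) (rec_maj_set k) \<and> avgstretch (n - 1) \<phi> \<le> 20"
proof (intro exI conjI)
  have "rec_maj_set k = {y \<in> cube (3 ^ k). maj_tree k y = True}"
    using assms(1) by (auto simp: rec_maj_set_def maj_tree_def)
  then show "bij_betw (rec_maj_bij k True) (cube (n - 1)) (rec_maj_set k)"
    using bij_betw_rec_maj_bij[of k True] assms(2) by simp
  show "avgstretch (n - 1) (rec_maj_bij k True) \<le> 20"
    using avgstretch_rec_maj_bij_le[OF assms(1), of True] assms(2) by simp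
qed

end
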